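(* Let $(X,\cdot)$ be a cycle set and $A$ an abelian group. Given an extension $(Y\xrightarrow{p}X,\,A)$ of $X$ by $A$ and a set-theoretic section $s\colon X\to Y$ of $p$, let $f\colon X\times X\to A$ be the $2$-cocycle determined by $f(x_1,x_2)\,s(x_1\cdot x_2)=s(x_1)\cdot s(x_2)$ for all $x_1,x_2\in X$. Assigning to the extension the class of $f$ yields a (well-defined) bijective correspondence between the set $\mathcal E(X,A)$ of equivalence classes of extensions of $X$ by $A$ and the cohomology group $H^2(X,A)$.
   Context: A cycle set is a set $X$ with a binary operation $\cdot$ satisfying $(a\cdot b)\cdot(a\cdot c)=(b\cdot a)\cdot(b\cdot c)$ and such that all left translations $a\mapsto b\cdot a$ are bijective. Cohomology of a cycle set with coefficients in an abelian group $A$ (written additively): $Z^2(X,A)$ is the group of maps $f\colon X\times X\to A$ with $f(x,z)+f(x\cdot y,x\cdot z)=f(y,z)+f(y\cdot x,y\cdot z)$ for all $x,y,z\in X$ ($2$-cocycles); $B^2(X,A)$ is the subgroup of maps of the form $(x,y)\mapsto\gamma(x\cdot y)-\gamma(y)$ for some map $\gamma\colon X\to A$; $H^2(X,A)=Z^2(X,A)/B^2(X,A)$. An (abelian) extension of $(X,\cdot)$ by $A$ is the data $(Y\xrightarrow{p}X,\,A)$, where $(Y,\cdot)$ is a cycle set endowed with a left $A$-action $(\alpha,y)\mapsto\alpha y$, and $p\colon Y\to X$ is a surjective cycle set homomorphism, such that: (1) $A$ acts regularly on each fiber $p^{-1}(x)$ (for all $y,z$ in the same fiber there is a unique $\alpha\in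 A$ with $\alpha z=y$); (2) $(\alpha y)\cdot z=y\cdot z$ and $y\cdot(\alpha z)=\alpha(y\cdot z)$ for all $\alpha\in A$, $y,z\in Y$. Extensions $(Y\xrightarrow{p}X,A)$ and $(Y'\xrightarrow{p'}X,A)$ are equivalent if there is a cycle set isomorphism $F\colon Y\to Y'$ with $p=p'\circ F$ and $F(\alpha y)=\alpha F(y)$ for all $\alpha\in A$, $y\in Y$. *)

theory Defs
  imports "HOL-Algebra.Group_Action"
begin

record 'x cycle_struct = "'x partial_object" +
  cdot :: "['x, 'x] \<Rightarrow> 'x"  (infixl "\<cdot>\<index>" 70)

locale cycle_set =
  fixes X (structure)
  assumes left_translation_bij:
    "b \<in> carrier X \<Longrightarrow> bij_betw (\<lambda>a. b \<cdot> a) (carrier X) (carrier X)"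
  and cycle_law:
    "\<lbrakk>a \<in> carrier X; b \<in> carrier X; c \<in> carrier X\<rbrakk>
      \<Longrightarrow> (a \<cdot> b) \<cdot> (a \<cdot> c) = (b \<cdot> a) \<cdot> (b \<cdot> c)"
begin

lemma cdot_closed [simp, intro]:
  "\<lbrakk>a \<in> carrier X; b \<in> carrier X\<rbrakk> \<Longrightarrow> a \<cdot> b \<in> carrier X"
  using left_translation_bij bij_betwE by blast

end

definition cycle_hom ::
    "('x, 'm) cycle_struct_scheme \<Rightarrow> ('y, 'n) cycle_struct_scheme \<Rightarrow> ('x \<Rightarrow> 'y) set" where
  "cycle_hom X Y = {h \<in> carrier X \<rightarrow> carrier Y.
     \<forall>a\<in>carrier X. \<forall>b\<in>carrier X. h (a \<cdot>\<^bsub>X\<^esub> b) = h a \<cdot>\<^bsub>Y\<^esub> h b}"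

definition cycle_iso ::
    "('x, 'm) cycle_struct_scheme \<Rightarrow> ('y, 'n) cycle_struct_scheme \<Rightarrow> ('x \<Rightarrow> 'y) set" where
  "cycle_iso X Y = {h \<in> cycle_hom X Y. bij_betw h (carrier X) (carrier Y)}"


text \<open>The coefficient group is a \<^locale>\<open>comm_group\<close>, hence in multiplicative notation:
  \<open>f \<otimes> g\<close> and \<open>inv f\<close> below are the sum and the negative of the additive convention.
  Maps \<open>X \<times> X \<rightarrow> A\<close> are extensional functions on the product of the carrier with itself.\<close>

definition cocycles2 ::
    "('x, 'm) cycle_struct_scheme \<Rightarrow> ('a, 'n) monoid_scheme \<Rightarrow> ('x \<times> 'x \<Rightarrow> 'a) monoid"  ("Z\<^sup>2") where
  "Z\<^sup>2 X A =
    \<lparr> carrier = {f \<in> carrier X \<times> carrier X \<rightarrow>\<^sub>E carrier A.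
        \<forall>x\<in>carrier X. \<forall>y\<in>carrier X. \<forall>z\<in>carrier X.
          f (x, z) \<otimes>\<^bsub>A\<^esub> f (x \<cdot>\<^bsub>X\<^esub> y, x \<cdot>\<^bsub>X\<^esub> z) =
          f (y, z) \<otimes>\<^bsub>A\<^esub> f (y \<cdot>\<^bsub>X\<^esub> x, y \<cdot>\<^bsub>X\<^esub> z)},
      mult = (\<lambda>f g. \<lambda>u \<in> carrier X \<times> carrier X. f u \<otimes>\<^bsub>A\<^esub> g u),
      one = (\<lambda>u \<in> carrier X \<times> carrier X. \<one>\<^bsub>A\<^esub>) \<rparr>"

definition coboundary ::
    "('x, 'm) cycle_struct_scheme \<Rightarrow> ('a, 'n) monoid_scheme \<Rightarrow> ('x \<Rightarrow> 'a) \<Rightarrow> ('x \<times> 'x \<Rightarrow> 'a)" where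
  "coboundary X A \<gamma> =
    (\<lambda>(x, y) \<in> carrier X \<times> carrier X. \<gamma> (x \<cdot>\<^bsub>X\<^esub> y) \<otimes>\<^bsub>A\<^esub> inv\<^bsub>A\<^esub> (\<gamma> y))"

definition coboundaries2 ::
    "('x, 'm) cycle_struct_scheme \<Rightarrow> ('a, 'n) monoid_scheme \<Rightarrow> ('x \<times> 'x \<Rightarrow> 'a) set"  ("B\<^sup>2") where
  "B\<^sup>2 X A = coboundary X A ` (carrier X \<rightarrow> carrier A)"

definition cohomology2 ::
    "('x, 'm) cycle_struct_scheme \<Rightarrow> ('a, 'n) monoid_scheme \<Rightarrow> ('x \<times> 'x \<Rightarrow> 'a) set monoid"  ("H\<^sup>2") where
  "H\<^sup>2 X A = Z\<^sup>2 X A Mod B\<^sup>2 X A"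

definition cohomology_class ::
    "('x, 'm) cycle_struct_scheme \<Rightarrow> ('a, 'n) monoid_scheme \<Rightarrow> ('x \<times> 'x \<Rightarrow> 'a) \<Rightarrow> ('x \<times> 'x \<Rightarrow> 'a) set" where
  "cohomology_class X A f = B\<^sup>2 X A #>\<^bsub>Z\<^sup>2 X A\<^esub> f"

lemma comm_group_cocycles2:
  assumes "cycle_set X" and "comm_group A"
  shows "comm_group (Z\<^sup>2 X A)"
proof -
  interpret X: cycle_set X by fact
  interpret A: comm_group A by fact
  show ?thesis
  proof (rule comm_groupI)
    fix f g assume f: "f \<in> carrier (Z\<^sup>2 X A)" and g: "g \<in> carrier (Z\<^sup>2 X A)"
    have cl: "f (x, y) \<in> carrier A" "g (x, y) \<in> carrier A"
      if "x \<in> carrier X" "y \<in> carrier X" for x y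
      using f g that by (auto simp: cocycles2_def)
    have exchange: "(a \<otimes>\<^bsub>A\<^esub> b) \<otimes>\<^bsub>A\<^esub> (c \<otimes>\<^bsub>A\<^esub> d) = (a' \<otimes>\<^bsub>A\<^esub> b') \<otimes>\<^bsub>A\<^esub> (c' \<otimes>\<^bsub>A\<^esub> d')"
      if "a \<otimes>\<^bsub>A\<^esub> c = a' \<otimes>\<^bsub>A\<^esub> c'" "b \<otimes>\<^bsub>A\<^esub> d = b' \<otimes>\<^bsub>A\<^esub> d'"
        "{a, b, c, d, a', b', c', d'} \<subseteq> carrier A" for a b c d a' b' c' d'
    proof -
      have swap: "(p \<otimes>\<^bsub>A\<^esub> q) \<otimes>\<^bsub>A\<^esub> (r \<otimes>\<^bsub>A\<^esub> t) = (p \<otimes>\<^bsub>A\<^esub> r) \<otimes>\<^bsub>A\<^esub> (q \<otimes>\<^bsub>A\<^esub> t)"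
        if "{p, q, r, t} \<subseteq> carrier A" for p q r t
        using that by (simp add: A.m_ac)
      show ?thesis
        using that(3) swap[of a b c d] swap[of a' b' c' d'] by (simp add: that(1,2))
    qed
    show "f \<otimes>\<^bsub>Z\<^sup>2 X A\<^esub> g \<in> carrier (Z\<^sup>2 X A)"
    proof -
      have "f (x, z) \<otimes>\<^bsub>A\<^esub> g (x, z) \<otimes>\<^bsub>A\<^esub> (f (x \<cdot>\<^bsub>X\<^esub> y, x \<cdot>\<^bsub>X\<^esub> z) \<otimes>\<^bsub>A\<^esub> g (x \<cdot>\<^bsub>X\<^esub> y, x \<cdot>\<^bsub>X\<^esub> z)) =
          f (y, z) \<otimes>\<^bsub>A\<^esub> g (y, z) \<otimes>\<^bsub>A\<^esub> (f (y \<cdot>\<^bsub>X\<^esub> x, y \<cdot>\<^bsub>X\<^esub> z) \<otimes>\<^bsub>A\<^esub> g (y \<cdot>\<^bsub>X\<^esub> x, y \<cdot>\<^bsub>X\<^esub> z))"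
        if xyz: "x \<in> carrier X" "y \<in> carrier X" "z \<in> carrier X" for x y z
      proof -
        have "f (x, z) \<otimes>\<^bsub>A\<^esub> f (x \<cdot>\<^bsub>X\<^esub> y, x \<cdot>\<^bsub>X\<^esub> z) = f (y, z) \<otimes>\<^bsub>A\<^esub> f (y \<cdot>\<^bsub>X\<^esub> x, y \<cdot>\<^bsub>X\<^esub> z)"
          using f xyz by (simp add: cocycles2_def)
        moreover have "g (x, z) \<otimes>\<^bsub>A\<^esub> g (x \<cdot>\<^bsub>X\<^esub> y, x \<cdot>\<^bsub>X\<^esub> z) = g (y, z) \<otimes>\<^bsub>A\<^esub> g (y \<cdot>\<^bsub>X\<^esub> x, y \<cdot>\<^bsub>X\<^esub> z)"
          using g xyz by (simp add: cocycles2_def)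
        ultimately show ?thesis
          using xyz cl by (intro exchange) auto
      qed
      then show ?thesis
        using cl by (auto simp: cocycles2_def)
    qed
    show "f \<otimes>\<^bsub>Z\<^sup>2 X A\<^esub> g = g \<otimes>\<^bsub>Z\<^sup>2 X A\<^esub> f"
      using cl by (auto simp: cocycles2_def A.m_comm intro!: restrict_ext)
    fix h assume h: "h \<in> carrier (Z\<^sup>2 X A)"
    have "h (x, y) \<in> carrier A" if "x \<in> carrier X" "y \<in> carrier X" for x y
      using h that by (auto simp: cocycles2_def)
    then show "f \<otimes>\<^bsub>Z\<^sup>2 X A\<^esub> g \<otimes>\<^bsub>Z\<^sup>2 X A\<^esub> h = f \<otimes>\<^bsub>Z\<^sup>2 X A\<^esub> (g \<otimes>\<^bsub>Z\<^sup>2 X A\<^esub> h)"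
      using cl by (auto simp: cocycles2_def A.m_assoc intro!: restrict_ext)
  next
    show "\<one>\<^bsub>Z\<^sup>2 X A\<^esub> \<in> carrier (Z\<^sup>2 X A)"
      by (auto simp: cocycles2_def)
  next
    fix f assume f: "f \<in> carrier (Z\<^sup>2 X A)"
    have cl: "f (x, y) \<in> carrier A" if "x \<in> carrier X" "y \<in> carrier X" for x y
      using f that by (auto simp: cocycles2_def)
    show "\<one>\<^bsub>Z\<^sup>2 X A\<^esub> \<otimes>\<^bsub>Z\<^sup>2 X A\<^esub> f = f"
      using f cl by (auto simp: cocycles2_def fun_eq_iff PiE_def extensional_def)
    let ?g = "\<lambda>u \<in> carrier X \<times> carrier X. inv\<^bsub>A\<^esub> (f u)"
    have "?g \<in> carrier (Z\<^sup>2 X A)"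
      using f cl by (auto simp: cocycles2_def A.inv_mult[symmetric])
    moreover have "?g \<otimes>\<^bsub>Z\<^sup>2 X A\<^esub> f = \<one>\<^bsub>Z\<^sup>2 X A\<^esub>"
      using cl by (auto simp: cocycles2_def intro!: restrict_ext)
    ultimately show "\<exists>g\<in>carrier (Z\<^sup>2 X A). g \<otimes>\<^bsub>Z\<^sup>2 X A\<^esub> f = \<one>\<^bsub>Z\<^sup>2 X A\<^esub>"
      by blast
  qed
qed

lemma coboundaries2_normal:
  assumes "cycle_set X" and "comm_group A"
  shows "B\<^sup>2 X A \<lhd> Z\<^sup>2 X A"
proof -
  interpret X: cycle_set X by fact
  interpret A: comm_group A by fact
  interpret Z: comm_group "Z\<^sup>2 X A" using assms by (rule comm_group_cocycles2)
  have canc: "(p \<otimes>\<^bsub>A\<^esub> inv\<^bsub>A\<^esub> q) \<otimes>\<^bsub>A\<^esub> (r \<otimes>\<^bsub>A\<^esub> inv\<^bsub>A\<^esub> p) = r \<otimes>\<^bsub>A\<^esub> inv\<^bsub>A\<^esub> q"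
    if "p \<in> carrier A" "q \<in> carrier A" "r \<in> carrier A" for p q r
  proof -
    have "(p \<otimes>\<^bsub>A\<^esub> inv\<^bsub>A\<^esub> q) \<otimes>\<^bsub>A\<^esub> (r \<otimes>\<^bsub>A\<^esub> inv\<^bsub>A\<^esub> p) = (p \<otimes>\<^bsub>A\<^esub> inv\<^bsub>A\<^esub> p) \<otimes>\<^bsub>A\<^esub> (r \<otimes>\<^bsub>A\<^esub> inv\<^bsub>A\<^esub> q)"
      using that by (simp only: A.m_ac A.inv_closed A.m_closed)
    then show ?thesis using that by simp
  qed
  have cob: "coboundary X A \<gamma> \<in> carrier (Z\<^sup>2 X A)" if "\<gamma> \<in> carrier X \<rightarrow> carrier A" for \<gamma>
  proof -
    have cl: "\<gamma> x \<in> carrier A" if "x \<in> carrier X" for x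
      using \<open>\<gamma> \<in> _\<close> that by auto
    show ?thesis
      by (auto simp: cocycles2_def coboundary_def cl canc X.cycle_law)
  qed
  have mult: "coboundary X A \<gamma> \<otimes>\<^bsub>Z\<^sup>2 X A\<^esub> coboundary X A \<delta>
      = coboundary X A (\<lambda>x. \<gamma> x \<otimes>\<^bsub>A\<^esub> \<delta> x)"
    if "\<gamma> \<in> carrier X \<rightarrow> carrier A" "\<delta> \<in> carrier X \<rightarrow> carrier A" for \<gamma> \<delta>
  proof -
    have cl: "\<gamma> x \<in> carrier A" "\<delta> x \<in> carrier A" if "x \<in> carrier X" for x
      using \<open>\<gamma> \<in> _\<close> \<open>\<delta> \<in> _\<close> that by auto
    show ?thesis
      by (auto simp: cocycles2_def coboundary_def cl A.inv_mult A.m_ac intro!: restrict_ext)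
  qed
  have "subgroup (B\<^sup>2 X A) (Z\<^sup>2 X A)"
  proof (rule Z.subgroupI)
    show "B\<^sup>2 X A \<subseteq> carrier (Z\<^sup>2 X A)"
      using cob by (auto simp: coboundaries2_def)
    show "B\<^sup>2 X A \<noteq> {}"
      by (auto simp: coboundaries2_def intro!: exI[of _ "\<lambda>_. \<one>\<^bsub>A\<^esub>"])
  next
    fix b assume "b \<in> B\<^sup>2 X A"
    then obtain \<gamma> where \<gamma>: "\<gamma> \<in> carrier X \<rightarrow> carrier A" and b: "b = coboundary X A \<gamma>"
      by (auto simp: coboundaries2_def)
    let ?d = "\<lambda>x. inv\<^bsub>A\<^esub> (\<gamma> x)"
    have d: "?d \<in> carrier X \<rightarrow> carrier A" using \<gamma> by auto
    have cl: "\<gamma> x \<in> carrier A" if "x \<in> carrier X" for x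
      using \<gamma> that by auto
    have "coboundary X A ?d \<otimes>\<^bsub>Z\<^sup>2 X A\<^esub> b = \<one>\<^bsub>Z\<^sup>2 X A\<^esub>"
      unfolding b mult[OF d \<gamma>]
      by (auto simp: cocycles2_def coboundary_def cl intro!: restrict_ext)
    then have "inv\<^bsub>Z\<^sup>2 X A\<^esub> b = coboundary X A ?d"
      using cob[OF d] cob[OF \<gamma>] b by (metis Z.inv_equality)
    then show "inv\<^bsub>Z\<^sup>2 X A\<^esub> b \<in> B\<^sup>2 X A"
      using d by (auto simp: coboundaries2_def)
  next
    fix b c assume "b \<in> B\<^sup>2 X A" "c \<in> B\<^sup>2 X A"
    then obtain \<gamma> \<delta> where gd: "\<gamma> \<in> carrier X \<rightarrow> carrier A" "\<delta> \<in> carrier X \<rightarrow> carrier A"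
      and bc: "b = coboundary X A \<gamma>" "c = coboundary X A \<delta>"
      by (auto simp: coboundaries2_def)
    have "(\<lambda>x. \<gamma> x \<otimes>\<^bsub>A\<^esub> \<delta> x) \<in> carrier X \<rightarrow> carrier A" using gd by auto
    then show "b \<otimes>\<^bsub>Z\<^sup>2 X A\<^esub> c \<in> B\<^sup>2 X A"
      unfolding bc mult[OF gd] by (auto simp: coboundaries2_def)
  qed
  then show ?thesis by (rule Z.subgroup_imp_normal)
qed


record ('a, 'x, 'y) extension =
  total_space :: "'y cycle_struct"
  proj :: "'y \<Rightarrow> 'x"
  act :: "'a \<Rightarrow> 'y \<Rightarrow> 'y"

text \<open>\<open>act_fiber\<close> and \<open>act_regular\<close> together say that \<open>A\<close> acts regularly on each fiber of
  the projection: the action preserves the fibers and is simply transitive on each of them.\<close>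

locale cycle_set_extension =
  fixes X :: "('x, 'm) cycle_struct_scheme" and A :: "('a, 'n) monoid_scheme"
    and E :: "('a, 'x, 'y) extension"
  assumes total_cycle_set: "cycle_set (total_space E)"
  and action: "group_action A (carrier (total_space E)) (act E)"
  and proj_hom: "proj E \<in> cycle_hom (total_space E) X"
  and proj_surj: "proj E ` carrier (total_space E) = carrier X"
  and act_fiber: "\<lbrakk>\<alpha> \<in> carrier A; y \<in> carrier (total_space E)\<rbrakk> \<Longrightarrow> proj E (act E \<alpha> y) = proj E y"
  and act_regular: "\<lbrakk>y \<in> carrier (total_space E); z \<in> carrier (total_space E); proj E y = proj E z\<rbrakk>
    \<Longrightarrow> \<exists>!\<alpha>. \<alpha> \<in> carrier A \<and> act E \<alpha> z = y"
  and act_left: "\<lbrakk>\<alpha> \<in> carrier A; y \<in> carrier (total_space E); z \<in> carrier (total_space E)\<rbrakk>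
    \<Longrightarrow> act E \<alpha> y \<cdot>\<^bsub>total_space E\<^esub> z = y \<cdot>\<^bsub>total_space E\<^esub> z"
  and act_right: "\<lbrakk>\<alpha> \<in> carrier A; y \<in> carrier (total_space E); z \<in> carrier (total_space E)\<rbrakk>
    \<Longrightarrow> y \<cdot>\<^bsub>total_space E\<^esub> act E \<alpha> z = act E \<alpha> (y \<cdot>\<^bsub>total_space E\<^esub> z)"

definition ext_equivalent ::
    "('a, 'n) monoid_scheme \<Rightarrow> ('a, 'x, 'y) extension \<Rightarrow> ('a, 'x, 'z) extension \<Rightarrow> bool" where
  "ext_equivalent A E E' \<longleftrightarrow> (\<exists>F \<in> cycle_iso (total_space E) (total_space E').
     (\<forall>y\<in>carrier (total_space E). proj E y = proj E' (F y)) \<and>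
     (\<forall>\<alpha>\<in>carrier A. \<forall>y\<in>carrier (total_space E). F (act E \<alpha> y) = act E' \<alpha> (F y)))"

text \<open>HOL cannot quantify over all sets \<open>Y\<close> inside a formula, so the total spaces range
  over the subsets of a type \<open>'y\<close>.  This loses nothing as soon as \<open>'y\<close> contains a copy of
  \<open>A \<times> X\<close>, since every total space is equipotent to \<open>A \<times> X\<close>.\<close>

definition ext_rel ::
    "('x, 'm) cycle_struct_scheme \<Rightarrow> ('a, 'n) monoid_scheme \<Rightarrow> (('a, 'x, 'y) extension) rel" where
  "ext_rel X A = {(E, E'). cycle_set_extension X A E \<and> cycle_set_extension X A E' \<and>
     ext_equivalent A E E'}"

lemma equiv_ext_rel: "equiv {E. cycle_set_extension X A E} (ext_rel X A)"
proof (rule equivI)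
  show "ext_rel X A \<subseteq> {E. cycle_set_extension X A E} \<times> {E. cycle_set_extension X A E}"
    by (auto simp: ext_rel_def)
  have "ext_equivalent A E E" for E
    unfolding ext_equivalent_def
    by (rule bexI[of _ id]) (auto simp: cycle_iso_def cycle_hom_def)
  then show "refl_on {E. cycle_set_extension X A E} (ext_rel X A)"
    by (auto simp: refl_on_def ext_rel_def)
next
  show "sym (ext_rel X A)"
  proof (rule symI)
    fix E E' assume EE': "(E, E') \<in> ext_rel X A"
    then obtain F where F: "F \<in> cycle_iso (total_space E) (total_space E')"
      and p: "\<And>y. y \<in> carrier (total_space E) \<Longrightarrow> proj E y = proj E' (F y)"
      and a: "\<And>\<alpha> y. \<lbrakk>\<alpha> \<in> carrier A; y \<in> carrier (total_space E)\<rbrakk> \<Longrightarrow> F (act E \<alpha> y) = act E' \<alpha> (F y)"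
      by (auto simp: ext_rel_def ext_equivalent_def)
    interpret E: cycle_set_extension X A E using EE' by (simp add: ext_rel_def)
    interpret T: cycle_set "total_space E" by (rule E.total_cycle_set)
    interpret act: group_action A "carrier (total_space E)" "act E" by (rule E.action)
    have bij: "bij_betw F (carrier (total_space E)) (carrier (total_space E'))"
      and hom: "\<And>y z. \<lbrakk>y \<in> carrier (total_space E); z \<in> carrier (total_space E)\<rbrakk>
        \<Longrightarrow> F (y \<cdot>\<^bsub>total_space E\<^esub> z) = F y \<cdot>\<^bsub>total_space E'\<^esub> F z"
      using F by (auto simp: cycle_iso_def cycle_hom_def)
    let ?G = "inv_into (carrier (total_space E)) F"
    have G: "bij_betw ?G (carrier (total_space E')) (carrier (total_space E))"
      using bij by (rule bij_betw_inv_into)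
    have Gc: "?G y \<in> carrier (total_space E)" and FG: "F (?G y) = y"
      if "y \<in> carrier (total_space E')" for y
      using that G bij by (auto simp: bij_betwE bij_betw_inv_into_right)
    have GF: "?G (F y) = y" if "y \<in> carrier (total_space E)" for y
      using that bij by (simp add: bij_betw_inv_into_left)
    have homG: "?G (y \<cdot>\<^bsub>total_space E'\<^esub> z) = ?G y \<cdot>\<^bsub>total_space E\<^esub> ?G z"
      if "y \<in> carrier (total_space E')" "z \<in> carrier (total_space E')" for y z
    proof -
      have "?G y \<cdot>\<^bsub>total_space E\<^esub> ?G z \<in> carrier (total_space E)"
        using that Gc by blast
      moreover have "F (?G y \<cdot>\<^bsub>total_space E\<^esub> ?G z) = y \<cdot>\<^bsub>total_space E'\<^esub> z"
        using hom[OF Gc[OF that(1)] Gc[OF that(2)]] FG that by simp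
      ultimately show ?thesis
        using GF by metis
    qed
    have actG: "?G (act E' \<alpha> y) = act E \<alpha> (?G y)"
      if "\<alpha> \<in> carrier A" "y \<in> carrier (total_space E')" for \<alpha> y
    proof -
      have "act E \<alpha> (?G y) \<in> carrier (total_space E)"
        using act.element_image that Gc by blast
      moreover have "F (act E \<alpha> (?G y)) = act E' \<alpha> y"
        using a[OF that(1) Gc[OF that(2)]] FG[OF that(2)] by simp
      ultimately show ?thesis
        using GF by metis
    qed
    have "ext_equivalent A E' E"
      unfolding ext_equivalent_def
      by (rule bexI[of _ ?G]) (auto simp: cycle_iso_def cycle_hom_def G Gc FG p homG actG)
    then show "(E', E) \<in> ext_rel X A"
      using EE' by (simp add: ext_rel_def)
  qed
next
  show "trans (ext_rel X A)"
  proof (rule transI)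
    fix E E' E'' assume 1: "(E, E') \<in> ext_rel X A" and 2: "(E', E'') \<in> ext_rel X A"
    from 1 obtain F where F: "F \<in> cycle_iso (total_space E) (total_space E')"
      and "\<forall>y\<in>carrier (total_space E). proj E y = proj E' (F y)"
      and "\<forall>\<alpha>\<in>carrier A. \<forall>y\<in>carrier (total_space E). F (act E \<alpha> y) = act E' \<alpha> (F y)"
      by (auto simp: ext_rel_def ext_equivalent_def)
    moreover from 2 obtain G where G: "G \<in> cycle_iso (total_space E') (total_space E'')"
      and "\<forall>y\<in>carrier (total_space E'). proj E' y = proj E'' (G y)"
      and "\<forall>\<alpha>\<in>carrier A. \<forall>y\<in>carrier (total_space E'). G (act E' \<alpha> y) = act E'' \<alpha> (G y)"
      by (auto simp: ext_rel_def ext_equivalent_def)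
    moreover have Fc: "F y \<in> carrier (total_space E')" if "y \<in> carrier (total_space E)" for y
      using F that by (auto simp: cycle_iso_def cycle_hom_def)
    moreover have "G \<circ> F \<in> cycle_iso (total_space E) (total_space E'')"
      using F G by (auto simp: cycle_iso_def cycle_hom_def Pi_iff intro: bij_betw_trans)
    ultimately have "ext_equivalent A E E''"
      unfolding ext_equivalent_def by (intro bexI[of _ "G \<circ> F"]) auto
    then show "(E, E'') \<in> ext_rel X A"
      using 1 2 by (simp add: ext_rel_def)
  qed
qed

definition ext_classes ::
    "('x, 'm) cycle_struct_scheme \<Rightarrow> ('a, 'n) monoid_scheme \<Rightarrow> ('a, 'x, 'y) extension set set"  ("\<E>") where
  "\<E> X A = {E. cycle_set_extension X A E} // ext_rel X A"

definition sections ::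
    "('x, 'm) cycle_struct_scheme \<Rightarrow> ('a, 'x, 'y) extension \<Rightarrow> ('x \<Rightarrow> 'y) set" where
  "sections X E = {s \<in> carrier X \<rightarrow> carrier (total_space E). \<forall>x\<in>carrier X. proj E (s x) = x}"

definition section_cocycle ::
    "('x, 'm) cycle_struct_scheme \<Rightarrow> ('a, 'n) monoid_scheme \<Rightarrow> ('a, 'x, 'y) extension \<Rightarrow>
     ('x \<Rightarrow> 'y) \<Rightarrow> ('x \<times> 'x \<Rightarrow> 'a)" where
  "section_cocycle X A E s =
    (\<lambda>(x\<^sub>1, x\<^sub>2) \<in> carrier X \<times> carrier X.
       THE \<alpha>. \<alpha> \<in> carrier A \<and> act E \<alpha> (s (x\<^sub>1 \<cdot>\<^bsub>X\<^esub> x\<^sub>2)) = s x\<^sub>1 \<cdot>\<^bsub>total_space E\<^esub> s x\<^sub>2)"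

definition ext_classes_to_H2 ::
    "('x, 'm) cycle_struct_scheme \<Rightarrow> ('a, 'n) monoid_scheme \<Rightarrow>
     ('a, 'x, 'y) extension set \<Rightarrow> ('x \<times> 'x \<Rightarrow> 'a) set" where
  "ext_classes_to_H2 X A c =
    (THE h. \<forall>E\<in>c. \<forall>s\<in>sections X E. h = cohomology_class X A (section_cocycle X A E s))"

end

theory Submission
  imports Defs
begin

text \<open>A section \<open>s\<close> of an extension \<open>E\<close> trivialises it: \<open>(\<alpha>, x) \<mapsto> \<alpha> s(x)\<close> is a bijection
  from \<open>A \<times> X\<close> onto the total space, under which the action becomes translation in the first
  factor and the operation becomes \<open>(\<alpha>, x) \<cdot> (\<beta>, y) = (\<beta> f(x, y), x \<cdot> y)\<close>, where \<open>f\<close> is the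
  cocycle of \<open>s\<close>.  Hence \<open>(E, s)\<close> is determined by \<open>f\<close>, and every cocycle occurs because the
  formula defines an extension.  Replacing \<open>s\<close> by \<open>\<gamma> s\<close> divides \<open>f\<close> by the coboundary of
  \<open>\<gamma>\<close>, and all sections arise in this way.\<close>

section \<open>Extensions with a chosen section: the cocycle and the chart\<close>

locale sectioned_extension =
  X: cycle_set X + A: comm_group A + cycle_set_extension X A E
  for X :: "('x, 'm) cycle_struct_scheme" (structure)
    and A :: "('a, 'n) monoid_scheme" and E :: "('a, 'x, 'y) extension" +
  fixes s :: "'x \<Rightarrow> 'y"
  assumes s_in_sections: "s \<in> sections X E"
begin

sublocale Y: cycle_set "total_space E"
  by (rule total_cycle_set)

sublocale action: group_action A "carrier (total_space E)" "act E"
  by (rule action)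

lemma act_closed [simp]:
  "\<lbrakk>\<alpha> \<in> carrier A; y \<in> carrier (total_space E)\<rbrakk> \<Longrightarrow> act E \<alpha> y \<in> carrier (total_space E)"
  using action.element_image by blast

lemma act_mult:
  "\<lbrakk>\<alpha> \<in> carrier A; \<beta> \<in> carrier A; y \<in> carrier (total_space E)\<rbrakk>
    \<Longrightarrow> act E (\<alpha> \<otimes>\<^bsub>A\<^esub> \<beta>) y = act E \<alpha> (act E \<beta> y)"
  using action.composition_rule by blast

text \<open>By \<open>act_fiber\<close> an orbit stays in one fiber, so the uniqueness half of
  \<open>act_regular\<close> applies. Below, identities in the coefficient group are proved by
  letting both sides act on a point.\<close>

lemma act_free:
  "\<lbrakk>\<alpha> \<in> carrier A; \<beta> \<in> carrier A; y \<in> carrier (total_space E); act E \<alpha> y = act E \<beta> y\<rbrakk>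
    \<Longrightarrow> \<alpha> = \<beta>"
  using act_regular[of "act E \<alpha> y" y] by (auto simp: act_fiber)

lemma proj_mult [simp]:
  "\<lbrakk>y \<in> carrier (total_space E); z \<in> carrier (total_space E)\<rbrakk>
    \<Longrightarrow> proj E (y \<cdot>\<^bsub>total_space E\<^esub> z) = proj E y \<cdot> proj E z"
  using proj_hom by (auto simp: cycle_hom_def)

lemma proj_closed [simp]: "y \<in> carrier (total_space E) \<Longrightarrow> proj E y \<in> carrier X"
  using proj_hom by (auto simp: cycle_hom_def)

lemma section_closed [simp]: "x \<in> carrier X \<Longrightarrow> s x \<in> carrier (total_space E)"
  using s_in_sections by (auto simp: sections_def)

lemma proj_section [simp]: "x \<in> carrier X \<Longrightarrow> proj E (s x) = x"
  using s_in_sections by (auto simp: sections_def)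

text \<open>As \<open>proj E\<close> is a homomorphism, \<open>s (x \<cdot> y)\<close> and the
  product of \<open>s x\<close> and \<open>s y\<close> both lie over \<open>x \<cdot> y\<close>, so
  regularity applies. This is what makes the \<open>THE\<close> in \<open>section_cocycle\<close>
  meaningful.\<close>

lemma section_mult_ex1:
  assumes "x \<in> carrier X" "y \<in> carrier X"
  shows "\<exists>!\<alpha>. \<alpha> \<in> carrier A \<and> act E \<alpha> (s (x \<cdot> y)) = s x \<cdot>\<^bsub>total_space E\<^esub> s y"
  using assms by (intro act_regular) auto

lemma section_cocycle_spec:
  assumes "x \<in> carrier X" "y \<in> carrier X"
  shows section_cocycle_closed [simp]: "section_cocycle X A E s (x, y) \<in> carrier A"
    and section_cocycle_act:
      "act E (section_cocycle X A E s (x, y)) (s (x \<cdot> y)) = s x \<cdot>\<^bsub>total_space E\<^esub> s y"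
  using theI'[OF section_mult_ex1[OF assms]] assms by (auto simp: section_cocycle_def)

lemma section_cocycle_eqI:
  assumes "x \<in> carrier X" "y \<in> carrier X" "\<alpha> \<in> carrier A"
    and "act E \<alpha> (s (x \<cdot> y)) = s x \<cdot>\<^bsub>total_space E\<^esub> s y"
  shows "section_cocycle X A E s (x, y) = \<alpha>"
  using assms section_cocycle_spec[OF assms(1,2)] by (intro act_free[of _ _ "s (x \<cdot> y)"]) auto

text \<open>\<open>act_left\<close> erases \<alpha>, \<open>act_right\<close> pulls \<beta> out in
  front, and what remains is the defining equation of the cocycle.\<close>

lemma chart_mult:
  assumes "\<alpha> \<in> carrier A" "\<beta> \<in> carrier A" "x \<in> carrier X" "y \<in> carrier X"
  shows "act E \<alpha> (s x) \<cdot>\<^bsub>total_space E\<^esub> act E \<beta> (s y)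
    = act E (\<beta> \<otimes>\<^bsub>A\<^esub> section_cocycle X A E s (x, y)) (s (x \<cdot> y))"
  using assms by (simp add: act_left act_right act_mult section_cocycle_act)

text \<open>The cycle law of the total space at \<open>s x\<close>, \<open>s y\<close>,
  \<open>s z\<close>, read in the chart, is the cocycle condition at \<open>x\<close>,
  \<open>y\<close>, \<open>z\<close>.\<close>

lemma section_cocycle_Z2: "section_cocycle X A E s \<in> carrier (Z\<^sup>2 X A)"
proof -
  let ?f = "section_cocycle X A E s"
  \<comment> \<open>The scalar \<open>?f (x, y)\<close> sits on the left factor, where
    \<open>chart_mult\<close> drops it; hence only two of the three cocycle values survive.\<close>
  have iterate: "(s x \<cdot>\<^bsub>total_space E\<^esub> s y) \<cdot>\<^bsub>total_space E\<^esub> (s x \<cdot>\<^bsub>total_space E\<^esub> s z)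
      = act E (?f (x, z) \<otimes>\<^bsub>A\<^esub> ?f (x \<cdot> y, x \<cdot> z)) (s ((x \<cdot> y) \<cdot> (x \<cdot> z)))"
    if "x \<in> carrier X" "y \<in> carrier X" "z \<in> carrier X" for x y z
    using chart_mult[of "?f (x, y)" "?f (x, z)" "x \<cdot> y" "x \<cdot> z"] that
    by (simp add: section_cocycle_act)
  \<comment> \<open>The two sides of the cycle law come with the base points
    \<open>(x \<cdot> y) \<cdot> (x \<cdot> z)\<close> and
    \<open>(y \<cdot> x) \<cdot> (y \<cdot> z)\<close>. These agree by the cycle law of
    \<open>X\<close>, so freeness at this point compares the scalars.\<close>
  have "?f (x, z) \<otimes>\<^bsub>A\<^esub> ?f (x \<cdot> y, x \<cdot> z) = ?f (y, z) \<otimes>\<^bsub>A\<^esub> ?f (y \<cdot> x, y \<cdot> z)"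
    if "x \<in> carrier X" "y \<in> carrier X" "z \<in> carrier X" for x y z
    using iterate[of x y z] iterate[of y x z] that
      Y.cycle_law[of "s x" "s y" "s z"] X.cycle_law[of x y z]
    by (intro act_free[of _ _ "s ((x \<cdot> y) \<cdot> (x \<cdot> z))"]) auto
  moreover have "?f \<in> extensional (carrier X \<times> carrier X)"
    by (simp add: section_cocycle_def)
  ultimately show ?thesis
    by (auto simp: cocycles2_def PiE_def)
qed

text \<open>Projecting recovers \<open>x\<close>, and then freeness recovers \<alpha>. A point
  \<open>y\<close> is reached from \<open>s (proj E y)\<close>, which shares its fiber.\<close>

lemma chart_bij:
  "bij_betw (\<lambda>(\<alpha>, x). act E \<alpha> (s x)) (carrier A \<times> carrier X) (carrier (total_space E))"
proof (rule bij_betwI')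
  fix u v assume "u \<in> carrier A \<times> carrier X" "v \<in> carrier A \<times> carrier X"
  then obtain \<alpha> x \<beta> y where u: "u = (\<alpha>, x)" "\<alpha> \<in> carrier A" "x \<in> carrier X"
    and v: "v = (\<beta>, y)" "\<beta> \<in> carrier A" "y \<in> carrier X"
    by auto
  have "x = y" if "act E \<alpha> (s x) = act E \<beta> (s y)"
    using act_fiber[of \<alpha> "s x"] act_fiber[of \<beta> "s y"] u v that by simp
  then show "((\<lambda>(\<alpha>, x). act E \<alpha> (s x)) u = (\<lambda>(\<alpha>, x). act E \<alpha> (s x)) v) = (u = v)"
    using u v act_free[of \<alpha> \<beta> "s x"] by auto
next
  fix u assume "u \<in> carrier A \<times> carrier X"
  then show "(\<lambda>(\<alpha>, x). act E \<alpha> (s x)) u \<in> carrier (total_space E)"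
    by auto
next
  fix y assume y: "y \<in> carrier (total_space E)"
  then obtain \<alpha> where "\<alpha> \<in> carrier A" "act E \<alpha> (s (proj E y)) = y"
    using act_regular[of y "s (proj E y)"] by auto
  then show "\<exists>u \<in> carrier A \<times> carrier X. y = (\<lambda>(\<alpha>, x). act E \<alpha> (s x)) u"
    using y by (intro bexI[of _ "(\<alpha>, proj E y)"]) auto
qed

lemma twisted_section:
  assumes "\<gamma> \<in> carrier X \<rightarrow> carrier A"
  shows "(\<lambda>x. act E (\<gamma> x) (s x)) \<in> sections X E"
  using assms by (auto simp: sections_def act_fiber Pi_iff)

text \<open>For the new section \<open>t\<close>, the product of \<open>t x\<close> and
  \<open>t y\<close> is a multiple of \<open>s (x \<cdot> y)\<close> in two ways: by
  \<open>\<gamma> y\<close> times the old cocycle value, from \<open>chart_mult\<close>, and by the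
  new cocycle value times \<open>\<gamma> (x \<cdot> y)\<close>, from its definition. The coboundary
  stands on the left to fit the right cosets that form the classes.\<close>

lemma section_cocycle_twist:
  assumes \<gamma>: "\<gamma> \<in> carrier X \<rightarrow> carrier A"
  shows "section_cocycle X A E s
    = coboundary X A \<gamma> \<otimes>\<^bsub>Z\<^sup>2 X A\<^esub> section_cocycle X A E (\<lambda>x. act E (\<gamma> x) (s x))"
proof -
  let ?t = "\<lambda>x. act E (\<gamma> x) (s x)"
  interpret t: sectioned_extension X A E ?t
    by unfold_locales (rule twisted_section[OF \<gamma>])
  have cl [simp]: "\<gamma> x \<in> carrier A" if "x \<in> carrier X" for x
    using \<gamma> that by auto
  have "section_cocycle X A E s (x, y)
      = \<gamma> (x \<cdot> y) \<otimes>\<^bsub>A\<^esub> inv\<^bsub>A\<^esub> \<gamma> y \<otimes>\<^bsub>A\<^esub> section_cocycle X A E ?t (x, y)"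
    if xy: "x \<in> carrier X" "y \<in> carrier X" for x y
  proof -
    have "act E (section_cocycle X A E ?t (x, y) \<otimes>\<^bsub>A\<^esub> \<gamma> (x \<cdot> y)) (s (x \<cdot> y))
        = act E (\<gamma> y \<otimes>\<^bsub>A\<^esub> section_cocycle X A E s (x, y)) (s (x \<cdot> y))"
      using t.section_cocycle_act[OF xy] chart_mult[of "\<gamma> x" "\<gamma> y" x y] xy
      by (simp add: act_mult)
    then have "section_cocycle X A E ?t (x, y) \<otimes>\<^bsub>A\<^esub> \<gamma> (x \<cdot> y)
        = \<gamma> y \<otimes>\<^bsub>A\<^esub> section_cocycle X A E s (x, y)"
      using xy by (intro act_free[of _ _ "s (x \<cdot> y)"]) auto
    then show ?thesis
      using xy A.inv_solve_left[of "section_cocycle X A E s (x, y)" "\<gamma> y"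
          "section_cocycle X A E ?t (x, y) \<otimes>\<^bsub>A\<^esub> \<gamma> (x \<cdot> y)"]
      by (simp add: A.m_ac)
  qed
  moreover have "section_cocycle X A E s \<in> extensional (carrier X \<times> carrier X)"
    by (simp add: section_cocycle_def)
  ultimately show ?thesis
    by (intro extensionalityI[of _ "carrier X \<times> carrier X"])
      (auto simp: cocycles2_def coboundary_def)
qed

end

section \<open>Equivalence of extensions in terms of cocycles\<close>

lemma (in cycle_set_extension) sections_nonempty: "sections X E \<noteq> {}"
proof -
  have "inv_into (carrier (total_space E)) (proj E) \<in> sections X E"
    using proj_surj by (auto simp: sections_def f_inv_into_f inv_into_into)
  then show ?thesis by blast
qed

text \<open>In the charts, the projection, the action and the operation depend on the section only
  through its cocycle, so matching points with equal coordinates is an equivalence. The two total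
  spaces may live in different types.\<close>

lemma ext_equivalent_if_section_cocycle_eq:
  assumes "sectioned_extension X A E s" "sectioned_extension X A E' s'"
    and eq: "section_cocycle X A E s = section_cocycle X A E' s'"
  shows "ext_equivalent A E E'"
proof -
  interpret E: sectioned_extension X A E s by fact
  interpret E': sectioned_extension X A E' s' by fact
  let ?D = "carrier A \<times> carrier X"
  let ?\<phi> = "\<lambda>(\<alpha>, x). act E \<alpha> (s x)" and ?\<phi>' = "\<lambda>(\<alpha>, x). act E' \<alpha> (s' x)"
  define F where "F = ?\<phi>' \<circ> inv_into ?D ?\<phi>"
  have bij: "bij_betw F (carrier (total_space E)) (carrier (total_space E'))"
    unfolding F_def using E.chart_bij E'.chart_bij bij_betw_inv_into bij_betw_trans by blast
  have F: "F (act E \<alpha> (s x)) = act E' \<alpha> (s' x)" if "\<alpha> \<in> carrier A" "x \<in> carrier X" for \<alpha> x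
    using bij_betw_inv_into_left[OF E.chart_bij, of "(\<alpha>, x)"] that by (simp add: F_def)
  have chart: "\<exists>\<alpha>\<in>carrier A. \<exists>x\<in>carrier X. y = act E \<alpha> (s x)"
    if "y \<in> carrier (total_space E)" for y
    using that bij_betw_imp_surj_on[OF E.chart_bij, symmetric] by auto
  have "F (y \<cdot>\<^bsub>total_space E\<^esub> z) = F y \<cdot>\<^bsub>total_space E'\<^esub> F z"
    if "y \<in> carrier (total_space E)" "z \<in> carrier (total_space E)" for y z
    using chart[OF that(1)] chart[OF that(2)]
    by (auto simp: E.chart_mult E'.chart_mult F eq)
  then have "F \<in> cycle_iso (total_space E) (total_space E')"
    using bij bij_betwE[OF bij] by (auto simp: cycle_iso_def cycle_hom_def)
  moreover have "proj E y = proj E' (F y)" if "y \<in> carrier (total_space E)" for y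
    using chart[OF that] by (auto simp: F E.act_fiber E'.act_fiber)
  moreover have "F (act E \<alpha> y) = act E' \<alpha> (F y)"
    if "\<alpha> \<in> carrier A" "y \<in> carrier (total_space E)" for \<alpha> y
    using chart[OF that(2)] that(1)
    by (auto simp: F E.act_mult[symmetric] E'.act_mult[symmetric])
  ultimately show ?thesis
    unfolding ext_equivalent_def by blast
qed

text \<open>The equivalence maps \<open>s\<close> to a section and preserves the defining equation
  of the cocycle. This reduces comparing sections of two extensions to comparing two sections of
  one.\<close>

lemma section_cocycle_transport:
  assumes E: "sectioned_extension X A E s" and E': "cycle_set_extension X A E'"
    and eqv: "ext_equivalent A E E'"
  obtains t where "t \<in> sections X E'" "section_cocycle X A E' t = section_cocycle X A E s"
proof -
  interpret E: sectioned_extension X A E s by fact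
  obtain F where F: "F \<in> cycle_iso (total_space E) (total_space E')"
    and p: "\<And>y. y \<in> carrier (total_space E) \<Longrightarrow> proj E y = proj E' (F y)"
    and a: "\<And>\<alpha> y. \<lbrakk>\<alpha> \<in> carrier A; y \<in> carrier (total_space E)\<rbrakk>
      \<Longrightarrow> F (act E \<alpha> y) = act E' \<alpha> (F y)"
    using eqv by (auto simp: ext_equivalent_def)
  have Fc: "F y \<in> carrier (total_space E')" if "y \<in> carrier (total_space E)" for y
    using F that by (auto simp: cycle_iso_def cycle_hom_def)
  have Fm: "F (y \<cdot>\<^bsub>total_space E\<^esub> z) = F y \<cdot>\<^bsub>total_space E'\<^esub> F z"
    if "y \<in> carrier (total_space E)" "z \<in> carrier (total_space E)" for y z
    using F that by (auto simp: cycle_iso_def cycle_hom_def)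
  have t: "F \<circ> s \<in> sections X E'"
    by (auto simp: sections_def Fc p[symmetric])
  interpret E': cycle_set_extension X A E' by fact
  interpret E': sectioned_extension X A E' "F \<circ> s"
    by unfold_locales (rule t)
  have "section_cocycle X A E' (F \<circ> s) (x, y) = section_cocycle X A E s (x, y)"
    if "x \<in> carrier X" "y \<in> carrier X" for x y
    using that a[of "section_cocycle X A E s (x, y)" "s (x \<cdot>\<^bsub>X\<^esub> y)"]
    by (intro E'.section_cocycle_eqI) (auto simp: E.section_cocycle_act Fm)
  then have "section_cocycle X A E' (F \<circ> s) = section_cocycle X A E s"
    by (intro extensionalityI[of _ "carrier X \<times> carrier X"])
      (auto simp: section_cocycle_def)
  with t that show thesis by blast
qed

text \<open>Cosets coincide as soon as a representative of one lies in the other. Spelled out, this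
  names the \<gamma> by which a section is to be twisted.\<close>

lemma cohomology_class_eq_iff:
  assumes "cycle_set X" "comm_group A" "f \<in> carrier (Z\<^sup>2 X A)" "g \<in> carrier (Z\<^sup>2 X A)"
  shows "cohomology_class X A f = cohomology_class X A g \<longleftrightarrow>
    (\<exists>\<gamma> \<in> carrier X \<rightarrow> carrier A. f = coboundary X A \<gamma> \<otimes>\<^bsub>Z\<^sup>2 X A\<^esub> g)"
proof -
  interpret Z: comm_group "Z\<^sup>2 X A" using assms(1,2) by (rule comm_group_cocycles2)
  interpret B: normal "B\<^sup>2 X A" "Z\<^sup>2 X A" using assms(1,2) by (rule coboundaries2_normal)
  have B: "subgroup (B\<^sup>2 X A) (Z\<^sup>2 X A)" by unfold_locales
  have "cohomology_class X A f = cohomology_class X A g \<longleftrightarrow> f \<in> cohomology_class X A g"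
    unfolding cohomology_class_def
    using Z.rcos_self[OF assms(3) B] Z.repr_independence[OF _ assms(4) B] by metis
  then show ?thesis
    by (auto simp: cohomology_class_def r_coset_def coboundaries2_def)
qed

text \<open>Transport yields a section of \<open>E'\<close> with the cocycle of \<open>s\<close>,
  and any two sections of \<open>E'\<close> differ by a twist, which changes the cocycle by a
  coboundary.\<close>

lemma cohomology_class_section_cocycle:
  assumes E: "sectioned_extension X A E s" and E': "sectioned_extension X A E' s'"
    and eqv: "ext_equivalent A E E'"
  shows "cohomology_class X A (section_cocycle X A E s)
    = cohomology_class X A (section_cocycle X A E' s')"
proof -
  interpret E: sectioned_extension X A E s by fact
  interpret E': sectioned_extension X A E' s' by fact
  obtain t where t: "t \<in> sections X E'"
    and eq: "section_cocycle X A E' t = section_cocycle X A E s"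
    using section_cocycle_transport[OF E E'.cycle_set_extension_axioms eqv] .
  interpret t: sectioned_extension X A E' t by unfold_locales (rule t)
  \<comment> \<open>\<open>t x\<close> and \<open>s' x\<close> lie in the same fiber; the scalars
    between them, chosen for all \<open>x\<close>, form \<gamma>.\<close>
  have "\<exists>\<alpha>. \<alpha> \<in> carrier A \<and> act E' \<alpha> (t x) = s' x" if "x \<in> carrier X" for x
    using E'.act_regular[of "s' x" "t x"] that by auto
  then obtain \<gamma> where \<gamma>: "\<And>x. x \<in> carrier X \<Longrightarrow> \<gamma> x \<in> carrier A \<and> act E' (\<gamma> x) (t x) = s' x"
    by metis
  \<comment> \<open>The twist of \<open>t\<close> is known to agree with \<open>s'\<close> on the
    carrier only, which is all that \<open>section_cocycle\<close> looks at.\<close>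
  have "section_cocycle X A E' (\<lambda>x. act E' (\<gamma> x) (t x)) = section_cocycle X A E' s'"
    using \<gamma> by (auto simp: section_cocycle_def fun_eq_iff restrict_def)
  then have "section_cocycle X A E s
      = coboundary X A \<gamma> \<otimes>\<^bsub>Z\<^sup>2 X A\<^esub> section_cocycle X A E' s'"
    using t.section_cocycle_twist[of \<gamma>] \<gamma> eq by auto
  then show ?thesis
    using \<gamma> cohomology_class_eq_iff[OF E.X.cycle_set_axioms E.A.comm_group_axioms
        E.section_cocycle_Z2 E'.section_cocycle_Z2] by auto
qed

text \<open>Twisting \<open>s'\<close> by the \<gamma> that relates the two cocycles makes them
  equal, which is the case already settled.\<close>

lemma ext_equivalent_if_cohomology_class_eq:
  assumes E: "sectioned_extension X A E s" and E': "sectioned_extension X A E' s'"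
    and eq: "cohomology_class X A (section_cocycle X A E s)
      = cohomology_class X A (section_cocycle X A E' s')"
  shows "ext_equivalent A E E'"
proof -
  interpret E: sectioned_extension X A E s by fact
  interpret E': sectioned_extension X A E' s' by fact
  interpret Z: comm_group "Z\<^sup>2 X A"
    by (rule comm_group_cocycles2) unfold_locales
  \<comment> \<open>The cocycle of \<open>s'\<close> is put on the left because \<open>s'\<close> is
    the section to be twisted: the twist formula then has the same left side and the same
    coboundary, which cancels in \<open>Z\<^sup>2 X A\<close>.\<close>
  obtain \<gamma> where \<gamma>: "\<gamma> \<in> carrier X \<rightarrow> carrier A"
    and tw: "section_cocycle X A E' s' = coboundary X A \<gamma> \<otimes>\<^bsub>Z\<^sup>2 X A\<^esub> section_cocycle X A E s"
    using eq cohomology_class_eq_iff[OF E.X.cycle_set_axioms E.A.comm_group_axioms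
        E'.section_cocycle_Z2 E.section_cocycle_Z2] by auto
  let ?t = "\<lambda>x. act E' (\<gamma> x) (s' x)"
  interpret t: sectioned_extension X A E' ?t
    by unfold_locales (rule E'.twisted_section[OF \<gamma>])
  have "coboundary X A \<gamma> \<in> carrier (Z\<^sup>2 X A)"
    using coboundaries2_normal[OF E.X.cycle_set_axioms E.A.comm_group_axioms] \<gamma>
    by (auto simp: coboundaries2_def dest!: normal_imp_subgroup subgroup.subset)
  moreover have "coboundary X A \<gamma> \<otimes>\<^bsub>Z\<^sup>2 X A\<^esub> section_cocycle X A E s
      = coboundary X A \<gamma> \<otimes>\<^bsub>Z\<^sup>2 X A\<^esub> section_cocycle X A E' ?t"
    using tw E'.section_cocycle_twist[OF \<gamma>] by simp
  ultimately have "section_cocycle X A E s = section_cocycle X A E' ?t"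
    using E.section_cocycle_Z2 t.section_cocycle_Z2 Z.Units_l_cancel by simp
  then show ?thesis
    using ext_equivalent_if_section_cocycle_eq[OF E t.sectioned_extension_axioms] by blast
qed

section \<open>Realising a cocycle by an extension\<close>

text \<open>This is \<open>A \<times> X\<close> with the operation twisted by \<open>f\<close>,
  copied into the type \<open>'y\<close> along \<iota>, with \<kappa> decoding. The action is
  restricted to the carrier because \<open>group_action\<close> asks for members of
  \<open>Bij\<close>, which are extensional.\<close>

definition cocycle_extension ::
    "('x, 'm) cycle_struct_scheme \<Rightarrow> ('a, 'n) monoid_scheme \<Rightarrow> ('a \<times> 'x \<Rightarrow> 'y) \<Rightarrow>
     ('x \<times> 'x \<Rightarrow> 'a) \<Rightarrow> ('a, 'x, 'y) extension" where
  "cocycle_extension X A \<iota> f = (let D = carrier A \<times> carrier X; \<kappa> = inv_into D \<iota> in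
    \<lparr> total_space = \<lparr> carrier = \<iota> ` D,
        cdot = (\<lambda>y z. \<iota> (fst (\<kappa> z) \<otimes>\<^bsub>A\<^esub> f (snd (\<kappa> y), snd (\<kappa> z)), snd (\<kappa> y) \<cdot>\<^bsub>X\<^esub> snd (\<kappa> z))) \<rparr>,
      proj = (\<lambda>y. snd (\<kappa> y)),
      act = (\<lambda>\<alpha>. \<lambda>y \<in> \<iota> ` D. \<iota> (\<alpha> \<otimes>\<^bsub>A\<^esub> fst (\<kappa> y), snd (\<kappa> y))) \<rparr>)"

text \<open>On coordinates \<open>\<iota> (a, x)\<close> the axioms reduce to those of
  \<open>X\<close> and \<open>A\<close>; the cocycle condition enters through the cycle law.\<close>

lemma cocycle_extension_exists:
  fixes X :: "('x, 'm) cycle_struct_scheme" and A :: "('a, 'n) monoid_scheme"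
    and \<iota> :: "'a \<times> 'x \<Rightarrow> 'y"
  assumes "cycle_set X" and "comm_group A" and \<iota>: "inj_on \<iota> (carrier A \<times> carrier X)"
    and f: "f \<in> carrier (Z\<^sup>2 X A)"
  obtains E :: "('a, 'x, 'y) extension" and s
  where "sectioned_extension X A E s" "section_cocycle X A E s = f"
proof -
  interpret X: cycle_set X by fact
  interpret A: comm_group A by fact
  define E where "E = cocycle_extension X A \<iota> f"
  let ?Y = "total_space E"
  have fc [simp]: "f (x, y) \<in> carrier A" if "x \<in> carrier X" "y \<in> carrier X" for x y
    using f that by (auto simp: cocycles2_def)
  have fcoc: "f (x, z) \<otimes>\<^bsub>A\<^esub> f (x \<cdot>\<^bsub>X\<^esub> y, x \<cdot>\<^bsub>X\<^esub> z) = f (y, z) \<otimes>\<^bsub>A\<^esub> f (y \<cdot>\<^bsub>X\<^esub> x, y \<cdot>\<^bsub>X\<^esub> z)"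
    if "x \<in> carrier X" "y \<in> carrier X" "z \<in> carrier X" for x y z
    using f that by (auto simp: cocycles2_def)
  have \<iota>_eq [simp]: "\<iota> (a, x) = \<iota> (b, y) \<longleftrightarrow> a = b \<and> x = y"
    if "a \<in> carrier A" "x \<in> carrier X" "b \<in> carrier A" "y \<in> carrier X" for a b x y
    using inj_on_eq_iff[OF \<iota>, of "(a, x)" "(b, y)"] that by simp
  have carr: "carrier ?Y = \<iota> ` (carrier A \<times> carrier X)"
    by (simp add: E_def cocycle_extension_def Let_def)
  have Y [simp]: "\<iota> (a, x) \<in> carrier ?Y" if "a \<in> carrier A" "x \<in> carrier X" for a x
    using that by (simp add: carr)
  have cases: "\<exists>a\<in>carrier A. \<exists>x\<in>carrier X. y = \<iota> (a, x)" if "y \<in> carrier ?Y" for y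
    using that by (auto simp: carr)
  have cdot [simp]: "\<iota> (a, x) \<cdot>\<^bsub>?Y\<^esub> \<iota> (b, y) = \<iota> (b \<otimes>\<^bsub>A\<^esub> f (x, y), x \<cdot>\<^bsub>X\<^esub> y)"
    if "a \<in> carrier A" "x \<in> carrier X" "b \<in> carrier A" "y \<in> carrier X" for a b x y
    using that by (simp add: E_def cocycle_extension_def Let_def inv_into_f_f[OF \<iota>])
  have proj [simp]: "proj E (\<iota> (a, x)) = x" if "a \<in> carrier A" "x \<in> carrier X" for a x
    using that by (simp add: E_def cocycle_extension_def Let_def inv_into_f_f[OF \<iota>])
  have act [simp]: "act E \<alpha> (\<iota> (a, x)) = \<iota> (\<alpha> \<otimes>\<^bsub>A\<^esub> a, x)"
    if "a \<in> carrier A" "x \<in> carrier X" for \<alpha> a x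
    using that by (simp add: E_def cocycle_extension_def Let_def inv_into_f_f[OF \<iota>])
  have act_ext: "act E \<alpha> \<in> extensional (carrier ?Y)" for \<alpha>
    by (simp add: E_def cocycle_extension_def Let_def)
  have "bij_betw (\<lambda>z. y \<cdot>\<^bsub>?Y\<^esub> z) (carrier ?Y) (carrier ?Y)" if y: "y \<in> carrier ?Y" for y
  proof -
    obtain a x where x: "a \<in> carrier A" "x \<in> carrier X" "y = \<iota> (a, x)"
      using cases[OF y] by blast
    have bij: "bij_betw (\<lambda>z. x \<cdot>\<^bsub>X\<^esub> z) (carrier X) (carrier X)"
      by (rule X.left_translation_bij[OF x(2)])
    have inj: "z = z'" if "x \<cdot>\<^bsub>X\<^esub> z = x \<cdot>\<^bsub>X\<^esub> z'" "z \<in> carrier X" "z' \<in> carrier X" for z z'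
      using bij that by (auto simp: bij_betw_def inj_on_def)
    show ?thesis
    proof (rule bij_betwI')
      fix u v assume uv: "u \<in> carrier ?Y" "v \<in> carrier ?Y"
      obtain b z c w where "b \<in> carrier A" "z \<in> carrier X" "u = \<iota> (b, z)"
        "c \<in> carrier A" "w \<in> carrier X" "v = \<iota> (c, w)"
        using cases[OF uv(1)] cases[OF uv(2)] by blast
      then show "(y \<cdot>\<^bsub>?Y\<^esub> u = y \<cdot>\<^bsub>?Y\<^esub> v) = (u = v)"
        using x by (auto dest: inj)
    next
      fix u assume "u \<in> carrier ?Y"
      then show "y \<cdot>\<^bsub>?Y\<^esub> u \<in> carrier ?Y"
        using cases[of u] x by auto
    next
      fix u assume "u \<in> carrier ?Y"
      then obtain b w where u: "b \<in> carrier A" "w \<in> carrier X" "u = \<iota> (b, w)"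
        using cases[of u] by blast
      obtain z where z: "z \<in> carrier X" "x \<cdot>\<^bsub>X\<^esub> z = w"
        using bij_betw_imp_surj_on[OF bij] u(2) by (metis imageE)
      \<comment> \<open>Left translation by \<open>y\<close> multiplies the first coordinate over
        \<open>z\<close> by \<open>f (x, z)\<close>, so the preimage has it divided out.\<close>
      then show "\<exists>v\<in>carrier ?Y. u = y \<cdot>\<^bsub>?Y\<^esub> v"
        using x u by (intro bexI[of _ "\<iota> (b \<otimes>\<^bsub>A\<^esub> inv\<^bsub>A\<^esub> f (x, z), z)"]) (auto simp: A.m_assoc)
    qed
  qed
  \<comment> \<open>With \<open>u\<close>, \<open>v\<close>, \<open>w\<close> over \<open>x\<close>,
    \<open>y\<close>, \<open>z\<close> and \<open>c\<close> the first coordinate of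
    \<open>w\<close>, the left side has first coordinate \<open>c\<close> times the left side of
    \<open>fcoc\<close>, and the right side likewise.\<close>
  moreover have "(u \<cdot>\<^bsub>?Y\<^esub> v) \<cdot>\<^bsub>?Y\<^esub> (u \<cdot>\<^bsub>?Y\<^esub> w) = (v \<cdot>\<^bsub>?Y\<^esub> u) \<cdot>\<^bsub>?Y\<^esub> (v \<cdot>\<^bsub>?Y\<^esub> w)"
    if "u \<in> carrier ?Y" "v \<in> carrier ?Y" "w \<in> carrier ?Y" for u v w
    using cases[OF that(1)] cases[OF that(2)] cases[OF that(3)]
    by (auto simp: A.m_assoc fcoc X.cycle_law)
  ultimately have cyc: "cycle_set ?Y"
    by (rule cycle_set.intro)
  have act_bij: "act E \<alpha> \<in> Bij (carrier ?Y)" if \<alpha>: "\<alpha> \<in> carrier A" for \<alpha>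
  proof -
    have "bij_betw (act E \<alpha>) (carrier ?Y) (carrier ?Y)"
    proof (rule bij_betwI')
      fix u v assume "u \<in> carrier ?Y" "v \<in> carrier ?Y"
      then show "(act E \<alpha> u = act E \<alpha> v) = (u = v)"
        using \<alpha> cases[of u] cases[of v] by auto
    next
      fix u assume "u \<in> carrier ?Y"
      then show "act E \<alpha> u \<in> carrier ?Y"
        using \<alpha> cases[of u] by auto
    next
      fix u assume "u \<in> carrier ?Y"
      then obtain b w where u: "b \<in> carrier A" "w \<in> carrier X" "u = \<iota> (b, w)"
        using cases[of u] by blast
      then show "\<exists>v\<in>carrier ?Y. u = act E \<alpha> v"
        using \<alpha> by (intro bexI[of _ "\<iota> (inv\<^bsub>A\<^esub> \<alpha> \<otimes>\<^bsub>A\<^esub> b, w)"]) (auto simp: A.m_assoc[symmetric])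
    qed
    then show ?thesis by (simp add: Bij_def act_ext)
  qed
  have "act E (\<alpha> \<otimes>\<^bsub>A\<^esub> \<beta>) = compose (carrier ?Y) (act E \<alpha>) (act E \<beta>)"
    if "\<alpha> \<in> carrier A" "\<beta> \<in> carrier A" for \<alpha> \<beta>
    by (rule extensionalityI[of _ "carrier ?Y"])
      (use that in \<open>auto simp: act_ext compose_eq A.m_assoc dest!: cases\<close>)
  then have "act E \<in> hom A (BijGroup (carrier ?Y))"
    by (intro homI) (auto simp: BijGroup_def act_bij)
  then have "group_action A (carrier ?Y) (act E)"
    by (auto simp: group_action_def group_hom_def group_hom_axioms_def
        group_BijGroup A.group_axioms)
  moreover have "proj E \<in> cycle_hom ?Y X"
    by (auto simp: cycle_hom_def dest!: cases)
  moreover have "x \<in> proj E ` carrier ?Y" if "x \<in> carrier X" for x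
    using that by (intro image_eqI[of _ _ "\<iota> (\<one>\<^bsub>A\<^esub>, x)"]) auto
  then have "proj E ` carrier ?Y = carrier X"
    by (auto dest!: cases)
  moreover have "\<exists>!\<alpha>. \<alpha> \<in> carrier A \<and> act E \<alpha> z = y"
    if yz: "y \<in> carrier ?Y" "z \<in> carrier ?Y" "proj E y = proj E z" for y z
  proof -
    obtain a b x where *: "a \<in> carrier A" "b \<in> carrier A" "x \<in> carrier X"
      "y = \<iota> (a, x)" "z = \<iota> (b, x)"
      using cases[OF yz(1)] cases[OF yz(2)] yz(3) by auto
    show ?thesis
    proof (rule ex1I[of _ "a \<otimes>\<^bsub>A\<^esub> inv\<^bsub>A\<^esub> b"])
      show "a \<otimes>\<^bsub>A\<^esub> inv\<^bsub>A\<^esub> b \<in> carrier A \<and> act E (a \<otimes>\<^bsub>A\<^esub> inv\<^bsub>A\<^esub> b) z = y"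
        using * by (auto simp: A.m_assoc)
    next
      fix \<alpha> assume "\<alpha> \<in> carrier A \<and> act E \<alpha> z = y"
      then show "\<alpha> = a \<otimes>\<^bsub>A\<^esub> inv\<^bsub>A\<^esub> b"
        using * by (auto simp: A.m_assoc)
    qed
  qed
  ultimately have ext: "cycle_set_extension X A E"
    using cyc by (intro cycle_set_extension.intro) (auto simp: A.m_assoc dest!: cases)
  \<comment> \<open>Products of points with first coordinate \<open>\<one>\<close> have first
    coordinate \<open>f (x, y)\<close>, so this section recovers \<open>f\<close> itself and not
    merely its class.\<close>
  let ?s = "\<lambda>x. \<iota> (\<one>\<^bsub>A\<^esub>, x)"
  interpret cycle_set_extension X A E by fact
  interpret s: sectioned_extension X A E ?s
    by unfold_locales (auto simp: sections_def)
  have "section_cocycle X A E ?s (x, y) = f (x, y)" if "x \<in> carrier X" "y \<in> carrier X" for x y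
    using that by (intro s.section_cocycle_eqI) auto
  then have "section_cocycle X A E ?s = f"
    using f by (intro extensionalityI[of _ "carrier X \<times> carrier X"])
      (auto simp: section_cocycle_def cocycles2_def PiE_def)
  then show thesis
    using that s.sectioned_extension_axioms by blast
qed

section \<open>The correspondence between extension classes and cohomology classes\<close>

text \<open>The injection \<iota> gives \<open>'y\<close> room for a copy of
  \<open>A \<times> X\<close>. The type \<open>'z\<close> is arbitrary, so the first three conjuncts
  concern extensions living anywhere and tie them to the classes counted in
  \<open>\<E> X A\<close>.\<close>

theorem theorem9p15:
  fixes X :: "('x, 'm) cycle_struct_scheme" and A :: "('a, 'n) monoid_scheme"
    and \<iota> :: "'a \<times> 'x \<Rightarrow> 'y"
  assumes "cycle_set X" and "comm_group A"
    and "inj_on \<iota> (carrier A \<times> carrier X)"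
  shows
    "(\<forall>E :: ('a, 'x, 'z) extension. cycle_set_extension X A E \<longrightarrow>
        (\<forall>s \<in> sections X E.
          (\<forall>x\<^sub>1 \<in> carrier X. \<forall>x\<^sub>2 \<in> carrier X.
            \<exists>!\<alpha>. \<alpha> \<in> carrier A \<and> act E \<alpha> (s (x\<^sub>1 \<cdot>\<^bsub>X\<^esub> x\<^sub>2)) = s x\<^sub>1 \<cdot>\<^bsub>total_space E\<^esub> s x\<^sub>2) \<and>
          section_cocycle X A E s \<in> carrier (Z\<^sup>2 X A))) \<and>
     (\<forall>(E :: ('a, 'x, 'z) extension) (E' :: ('a, 'x, 'y) extension).
        cycle_set_extension X A E \<and> cycle_set_extension X A E' \<and> ext_equivalent A E E' \<longrightarrow>
        (\<forall>s \<in> sections X E. \<forall>s' \<in> sections X E'.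
          cohomology_class X A (section_cocycle X A E s) =
          cohomology_class X A (section_cocycle X A E' s'))) \<and>
     (\<forall>E :: ('a, 'x, 'z) extension. cycle_set_extension X A E \<longrightarrow>
        (\<exists>E' :: ('a, 'x, 'y) extension.
          cycle_set_extension X A E' \<and> ext_equivalent A E E')) \<and>
     bij_betw (ext_classes_to_H2 X A)
       (\<E> X A :: ('a, 'x, 'y) extension set set) (carrier (H\<^sup>2 X A))"
proof -
  interpret X: cycle_set X by fact
  interpret A: comm_group A by fact
  let ?R = "ext_rel X A :: ('a, 'x, 'y) extension rel"
  let ?\<Phi> = "ext_classes_to_H2 X A :: ('a, 'x, 'y) extension set \<Rightarrow> _"
  note sec = sectioned_extension.intro[OF assms(1,2) _ sectioned_extension_axioms.intro]
  \<comment> \<open>This evaluates the \<open>THE\<close>: invariance under equivalence shows that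
    the value fits every choice, and a competing \<open>h\<close> must already fit \<open>E\<close>
    with \<open>s\<close>.\<close>
  have \<Phi>: "?\<Phi> (?R `` {E}) = cohomology_class X A (section_cocycle X A E s)"
    if E: "cycle_set_extension X A E" and s: "s \<in> sections X E" for E s
    unfolding ext_classes_to_H2_def
  proof (rule the_equality)
    show "\<forall>E'\<in>?R `` {E}. \<forall>s'\<in>sections X E'. cohomology_class X A (section_cocycle X A E s)
        = cohomology_class X A (section_cocycle X A E' s')"
      using E s by (intro ballI cohomology_class_section_cocycle[OF sec sec]) (auto simp: ext_rel_def)
  next
    fix h assume h: "\<forall>E'\<in>?R `` {E}. \<forall>s'\<in>sections X E'.
      h = cohomology_class X A (section_cocycle X A E' s')"
    have "E \<in> ?R `` {E}"
      using equiv_class_self[OF equiv_ext_rel] E by blast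
    then show "h = cohomology_class X A (section_cocycle X A E s)"
      using h s by blast
  qed
  have H2: "carrier (H\<^sup>2 X A) = cohomology_class X A ` carrier (Z\<^sup>2 X A)"
    by (auto simp: cohomology2_def FactGroup_def RCOSETS_def cohomology_class_def)
  have "bij_betw ?\<Phi> (\<E> X A) (carrier (H\<^sup>2 X A))"
  proof (rule bij_betw_imageI)
    show "inj_on ?\<Phi> (\<E> X A)"
    proof (rule inj_onI)
      fix c c' assume "c \<in> \<E> X A" "c' \<in> \<E> X A" and eq: "?\<Phi> c = ?\<Phi> c'"
      then obtain E E' where c: "cycle_set_extension X A E" "c = ?R `` {E}"
        and c': "cycle_set_extension X A E'" "c' = ?R `` {E'}"
        by (auto simp: ext_classes_def elim!: quotientE)
      \<comment> \<open>Through chosen sections, equal values of the map become cohomologous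
        cocycles.\<close>
      obtain s s' where s: "s \<in> sections X E" "s' \<in> sections X E'"
        using c(1) c'(1) cycle_set_extension.sections_nonempty by blast
      have "ext_equivalent A E E'"
        using eq
        by (intro ext_equivalent_if_cohomology_class_eq[OF sec[OF c(1) s(1)] sec[OF c'(1) s(2)]])
          (simp add: c(2) c'(2) \<Phi>[OF c(1) s(1)] \<Phi>[OF c'(1) s(2)])
      then show "c = c'"
        using c c' equiv_class_eq[OF equiv_ext_rel, of E E' X A] by (simp add: ext_rel_def)
    qed
    have "?\<Phi> c \<in> carrier (H\<^sup>2 X A)" if c_class: "c \<in> \<E> X A" for c
    proof -
      obtain E where c: "cycle_set_extension X A E" "c = ?R `` {E}"
        using c_class by (auto simp: ext_classes_def elim!: quotientE)
      obtain s where s: "s \<in> sections X E"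
        using c(1) cycle_set_extension.sections_nonempty by blast
      then show ?thesis
        using H2 sectioned_extension.section_cocycle_Z2[OF sec[OF c(1) s]]
        by (simp add: c(2) \<Phi>[OF c(1) s])
    qed
    \<comment> \<open>Surjectivity: a representing cocycle is realised exactly by an extension
      inside \<open>'y\<close>.\<close>
    moreover have "h \<in> ?\<Phi> ` \<E> X A" if h: "h \<in> carrier (H\<^sup>2 X A)" for h
    proof -
      obtain f where f: "f \<in> carrier (Z\<^sup>2 X A)" "h = cohomology_class X A f"
        using h H2 by blast
      obtain E :: "('a, 'x, 'y) extension" and s
        where Es: "sectioned_extension X A E s" "section_cocycle X A E s = f"
        using cocycle_extension_exists[OF assms f(1)] .
      interpret sectioned_extension X A E s by fact
      have "?R `` {E} \<in> \<E> X A"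
        using cycle_set_extension_axioms by (auto simp: ext_classes_def intro: quotientI)
      moreover have "h = ?\<Phi> (?R `` {E})"
        using \<Phi>[OF cycle_set_extension_axioms s_in_sections] f Es by simp
      ultimately show ?thesis by blast
    qed
    ultimately show "?\<Phi> ` \<E> X A = carrier (H\<^sup>2 X A)"
      by blast
  qed
  \<comment> \<open>An extension in \<open>'z\<close> is rebuilt inside \<open>'y\<close> from its
    own cocycle; equality of cocycles then gives the equivalence.\<close>
  moreover have "\<exists>E' :: ('a, 'x, 'y) extension. cycle_set_extension X A E' \<and> ext_equivalent A E E'"
    if E: "cycle_set_extension X A E" for E :: "('a, 'x, 'z) extension"
  proof -
    obtain s where s: "s \<in> sections X E"
      using E cycle_set_extension.sections_nonempty by blast
    obtain E' :: "('a, 'x, 'y) extension" and s'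
      where E': "sectioned_extension X A E' s'" "section_cocycle X A E' s' = section_cocycle X A E s"
      using cocycle_extension_exists[OF assms
          sectioned_extension.section_cocycle_Z2[OF sec[OF E s]]] .
    have "ext_equivalent A E E'"
      by (rule ext_equivalent_if_section_cocycle_eq[OF sec[OF E s] E'(1) E'(2)[symmetric]])
    then show ?thesis
      using sectioned_extension.axioms(3)[OF E'(1)] by blast
  qed
  moreover have "(\<forall>x\<^sub>1 \<in> carrier X. \<forall>x\<^sub>2 \<in> carrier X.
        \<exists>!\<alpha>. \<alpha> \<in> carrier A \<and> act E \<alpha> (s (x\<^sub>1 \<cdot>\<^bsub>X\<^esub> x\<^sub>2)) = s x\<^sub>1 \<cdot>\<^bsub>total_space E\<^esub> s x\<^sub>2) \<and>
      section_cocycle X A E s \<in> carrier (Z\<^sup>2 X A)"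
    if "cycle_set_extension X A E" "s \<in> sections X E" for E :: "('a, 'x, 'z) extension" and s
    using sectioned_extension.section_mult_ex1[OF sec[OF that]]
      sectioned_extension.section_cocycle_Z2[OF sec[OF that]]
    by blast
  moreover have "cohomology_class X A (section_cocycle X A E s)
      = cohomology_class X A (section_cocycle X A E' s')"
    if "cycle_set_extension X A E \<and> cycle_set_extension X A E' \<and> ext_equivalent A E E'"
      "s \<in> sections X E" "s' \<in> sections X E'"
    for E :: "('a, 'x, 'z) extension" and E' :: "('a, 'x, 'y) extension" and s s'
    using that by (intro cohomology_class_section_cocycle[OF sec sec]) auto
  ultimately show ?thesis
    by (intro conjI allI impI ballI) simp_all
qed

end
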